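(* Let $Y$ be a real topological vector space, $F\subset Y$, $D\subset Y$ a convex cone with $k\in\operatorname{int}D$, and suppose that $F+D$ is a nonempty closed proper subset of $Y$. Put $B:=Y\setminus\operatorname{int}(F+D)$. Then $$\operatorname{WEff}(F,D)=\{y^0\in F\mid\varphi_{F+D,-k}(y^0)=\max_{y\in F}\varphi_{F+D,-k}(y)=0\}=\{y^0\in F\mid\varphi_{B,k}(y^0)=\min_{y\in F}\varphi_{B,k}(y)=0\}.$$ $\varphi_{F+D,-k}$ and $\varphi_{B,k}$ are finite-valued and continuous. $\varphi_{B,k}$ is strictly $(\operatorname{int}D)$-monotone, whereas $\varphi_{F+D,-k}$ is strictly $(-\operatorname{int}D)$-monotone. If $F+D$ is convex, then $\varphi_{F+D,-k}$ is convex and $\varphi_{B,k}$ is concave.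
   Context: For $A\subseteq Y$ and $v\in Y$, $\varphi_{A,v}(y):=\inf\{t\in\mathbb{R}\mid y\in A+tv\}$ for $y\in Y$; so $\varphi_{F+D,-k}(y)=\inf\{t\in\mathbb{R}\mid y\in F+D-tk\}$ and $\varphi_{B,k}(y)=\inf\{t\in\mathbb{R}\mid y\in B+tk\}$ (with $\inf\emptyset:=\nu$, a symbol outside the extended reals). Finite-valued means all values are in $\mathbb{R}$. $\operatorname{Eff}(F,D):=\{y^0\in F\mid F\cap(y^0-D)\subseteq\{y^0\}\}$ and $\operatorname{WEff}(F,D):=\operatorname{Eff}(F,\operatorname{int}D)$. A cone is a set $C\subseteq Y$ with $\mathbb{R}_+C\subseteq C$, $\mathbb{R}_+=\{x\in\mathbb{R}\mid x\ge0\}$. A functional $\varphi:Y\to\mathbb{R}$ is strictly $E$-monotone ($E\subseteq Y$) if $y^2-y^1\in E\setminus\{0\}$ implies $\varphi(y^1)<\varphi(y^2)$. *)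

theory Defs
  imports "HOL-Analysis.Analysis"
begin

text \<open>Real topological vector spaces; no separation axiom is assumed.\<close>

class real_topological_vector_space = topological_ab_group_add + real_vector +
  assumes tendsto_scaleR_Pair: "LIM x (nhds c \<times>\<^sub>F nhds a). fst x *\<^sub>R snd x :> nhds (c *\<^sub>R a)"

instance real_normed_vector < real_topological_vector_space
proof
  fix c :: real and a :: 'a
  have "(fst \<longlongrightarrow> c) (nhds c \<times>\<^sub>F nhds a)" "(snd \<longlongrightarrow> a) (nhds c \<times>\<^sub>F nhds a)"
    by (rule filterlim_fst filterlim_snd)+
  then show "LIM x (nhds c \<times>\<^sub>F nhds a). fst x *\<^sub>R snd x :> nhds (c *\<^sub>R a)"
    by (rule tendsto_scaleR)
qed

text \<open>
  The values of a translation functional lie in the extended reals together with an additional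
  symbol \<open>\<nu>\<close>, the infimum of the empty set. \<open>None\<close> plays the role of \<open>\<nu>\<close>.
  In the theorem, sums \<open>A + B\<close> of sets are Minkowski sums, whereas \<open>A - B\<close> is set difference.
\<close>

definition inf_nu :: "real set \<Rightarrow> ereal option" where
  "inf_nu T = (if T = {} then None else Some (Inf (ereal ` T)))"

definition translation_functional ::
    "'a::real_vector set \<Rightarrow> 'a \<Rightarrow> 'a \<Rightarrow> ereal option" where
  "translation_functional A v y = inf_nu {t. y \<in> A + {t *\<^sub>R v}}"

definition finite_valued :: "('a \<Rightarrow> ereal option) \<Rightarrow> bool" where
  "finite_valued \<phi> \<longleftrightarrow> (\<forall>y. \<exists>r::real. \<phi> y = Some (ereal r))"

text \<open>Only meaningful for finite-valued functionals: \<open>\<nu>\<close> and infinite values become junk.\<close>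

definition real_valued :: "('a \<Rightarrow> ereal option) \<Rightarrow> 'a \<Rightarrow> real" where
  "real_valued \<phi> y = real_of_ereal (the (\<phi> y))"

text \<open>\<open>\<nu>\<close> is not comparable with any value.\<close>

definition le_nu :: "ereal option \<Rightarrow> ereal option \<Rightarrow> bool" where
  "le_nu p q \<longleftrightarrow> (\<exists>a b. p = Some a \<and> q = Some b \<and> a \<le> b)"

definition is_maximum_on :: "('a \<Rightarrow> ereal option) \<Rightarrow> 'a set \<Rightarrow> ereal option \<Rightarrow> bool" where
  "is_maximum_on \<phi> F m \<longleftrightarrow> m \<in> \<phi> ` F \<and> (\<forall>y\<in>F. le_nu (\<phi> y) m)"

definition is_minimum_on :: "('a \<Rightarrow> ereal option) \<Rightarrow> 'a set \<Rightarrow> ereal option \<Rightarrow> bool" where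
  "is_minimum_on \<phi> F m \<longleftrightarrow> m \<in> \<phi> ` F \<and> (\<forall>y\<in>F. le_nu m (\<phi> y))"

definition Eff :: "'a::ab_group_add set \<Rightarrow> 'a set \<Rightarrow> 'a set" where
  "Eff F D = {y0 \<in> F. F \<inter> (\<lambda>d. y0 - d) ` D \<subseteq> {y0}}"

definition WEff :: "'a::{ab_group_add, topological_space} set \<Rightarrow> 'a set \<Rightarrow> 'a set" where
  "WEff F D = Eff F (interior D)"

definition strictly_monotone_wrt :: "'a::ab_group_add set \<Rightarrow> ('a \<Rightarrow> real) \<Rightarrow> bool" where
  "strictly_monotone_wrt E f \<longleftrightarrow> (\<forall>y1 y2. y2 - y1 \<in> E - {0} \<longrightarrow> f y1 < f y2)"

end

theory Submission
  imports Defs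
begin

text \<open>
  Put \<open>A = F + D\<close>. Since \<open>D + D \<subseteq> D\<close>, the set \<open>A\<close> absorbs the addition of elements of \<open>D\<close>, so it
  meets every line in direction \<open>k\<close> in an upward unbounded interval of parameters. Because
  \<open>k\<close> is interior to \<open>D\<close>, a large multiple of \<open>k\<close> dominates any given vector; hence none of these
  intervals is empty (as \<open>A\<close> is nonempty) or all of the real line (as \<open>A\<close> is proper). The left endpoint \<open>\<tau> y\<close> for the line
  through \<open>y\<close> is therefore a real number, and it is the value of \<open>\<phi>\<^bsub>A,-k\<^esub>\<close> at \<open>y\<close>.

  Everything rests on one equivalence, \<open>entry_time_less_iff\<close>:
  \<open>\<tau> y < r\<close> holds iff \<open>y + r k\<close> is interior to \<open>A\<close>. It gives \<open>\<tau> (y + s k) = \<tau> y - s\<close>, it shows that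
  \<open>\<tau>\<close> does not increase along \<open>D\<close>, and these two facts together give continuity (\<open>\<tau>\<close> varies by at most
  \<open>\<epsilon>\<close> on the order interval around \<open>y\<close> bounded by \<open>y - \<epsilon> k\<close> and \<open>y + \<epsilon> k\<close>) and strict monotonicity. It
  also shows that \<open>y - t k\<close> lies outside the interior of \<open>A\<close> exactly if \<open>t \<ge> - \<tau> y\<close>. So the second
  functional is simply \<open>- \<tau>\<close>, and each claim about it mirrors one about \<open>\<tau>\<close>.

  For the efficient points, \<open>int (F + D) = F + int D\<close>: an interior point \<open>y\<close> of \<open>F + D\<close> can be moved
  a little along \<open>-k\<close> without leaving \<open>F + D\<close>. Since \<open>0\<close> is not in \<open>int D\<close>, a point of \<open>F\<close> is weakly
  efficient iff it is outside \<open>F + int D\<close>, that is, iff \<open>\<tau> y \<ge> 0\<close>; and \<open>\<tau> \<le> 0\<close> on all of \<open>F\<close> because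
  \<open>F \<subseteq> A\<close>.
\<close>

section \<open>Scaling and interiors in topological vector spaces\<close>

lemma continuous_on_scaleR_tvs:
  fixes g :: "'b::topological_space \<Rightarrow> 'a::real_topological_vector_space"
  assumes f: "continuous_on S f" and g: "continuous_on S g"
  shows "continuous_on S (\<lambda>x. f x *\<^sub>R g x)"
  unfolding continuous_on_def
proof
  fix x assume x: "x \<in> S"
  have "((\<lambda>x. (f x, g x)) \<longlongrightarrow> (f x, g x)) (at x within S)"
    using f g x by (intro tendsto_Pair) (auto simp: continuous_on_def)
  then have "LIM z at x within S. (f z, g z) :> nhds (f x) \<times>\<^sub>F nhds (g x)"
    by (simp add: nhds_prod)
  from filterlim_compose[OF tendsto_scaleR_Pair this]
  show "((\<lambda>x. f x *\<^sub>R g x) \<longlongrightarrow> f x *\<^sub>R g x) (at x within S)"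
    by simp
qed

lemma open_contains_segment_around:
  fixes U :: "'a::real_topological_vector_space set"
  assumes "open U" "x \<in> U"
  obtains e where "e > 0" "\<And>t. \<bar>t\<bar> \<le> e \<Longrightarrow> x + t *\<^sub>R v \<in> U"
proof -
  have "open ((\<lambda>t. x + t *\<^sub>R v) -` U)"
    by (intro open_vimage assms continuous_on_add continuous_on_scaleR_tvs
        continuous_on_id continuous_on_const)
  moreover have "0 \<in> (\<lambda>t. x + t *\<^sub>R v) -` U"
    using assms by simp
  ultimately obtain e where "e > 0" "cball 0 e \<subseteq> (\<lambda>t. x + t *\<^sub>R v) -` U"
    by (meson open_contains_cball)
  then show thesis
    by (intro that[of e]) (auto simp: subset_iff dist_norm)
qed

lemma interior_translate_subset:
  fixes X Y :: "'a::topological_ab_group_add set"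
  assumes "x \<in> interior X" and "\<And>z. z \<in> X \<Longrightarrow> a + z \<in> Y"
  shows "a + x \<in> interior Y"
proof -
  have "open ((\<lambda>z. z - a) -` interior X)"
    by (intro open_vimage open_interior continuous_on_diff continuous_on_id continuous_on_const)
  moreover have "(\<lambda>z. z - a) -` interior X \<subseteq> Y"
  proof
    fix z assume "z \<in> (\<lambda>z. z - a) -` interior X"
    then have "z - a \<in> X"
      using interior_subset by auto
    from assms(2)[OF this] show "z \<in> Y"
      by simp
  qed
  ultimately show ?thesis
    using assms(1) by (intro interiorI[of "(\<lambda>z. z - a) -` interior X"]) auto
qed

lemma cone_interior_scaleR:
  fixes D :: "'a::real_topological_vector_space set"
  assumes "cone D" "x \<in> interior D" "c > 0"
  shows "c *\<^sub>R x \<in> interior D"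
proof -
  let ?U = "(\<lambda>z. inverse c *\<^sub>R z) -` interior D"
  have "open ?U"
    by (intro open_vimage open_interior continuous_on_scaleR_tvs continuous_on_id
        continuous_on_const)
  moreover have "?U \<subseteq> D"
  proof
    fix z assume "z \<in> ?U"
    then have "inverse c *\<^sub>R z \<in> D"
      using interior_subset by auto
    with assms have "c *\<^sub>R (inverse c *\<^sub>R z) \<in> D"
      by (meson cone_def less_imp_le)
    with assms show "z \<in> D"
      by simp
  qed
  ultimately show ?thesis
    using assms by (intro interiorI[of ?U]) auto
qed

lemma cone_interior_absorbs:
  fixes D :: "'a::real_topological_vector_space set"
  assumes "cone D" "k \<in> interior D"
  obtains t where "t > 0" "t *\<^sub>R k + v \<in> D"
proof -
  obtain e where e: "e > 0" "\<And>t. \<bar>t\<bar> \<le> e \<Longrightarrow> k + t *\<^sub>R v \<in> interior D"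
    using open_contains_segment_around[OF open_interior assms(2)] by metis
  then have "k + e *\<^sub>R v \<in> D"
    using interior_subset by (metis abs_of_pos order_refl subsetD)
  then have "inverse e *\<^sub>R (k + e *\<^sub>R v) \<in> D"
    using assms(1) e(1) by (simp add: cone_def)
  then show thesis
    using e(1) by (intro that[of "inverse e"]) (auto simp: scaleR_add_right)
qed

section \<open>Infima of sets of parameters\<close>

lemma inf_nu_eq_Inf:
  assumes "T \<noteq> {}" "bdd_below T"
  shows "inf_nu T = Some (ereal (Inf T))"
proof -
  have "Inf (ereal ` T) = ereal (Inf T)"
    using assms by (intro antisym)
      (auto intro!: INF_greatest cInf_lower simp: ereal_Inf')
  with assms(1) show ?thesis
    by (simp add: inf_nu_def)
qed

lemma mem_plus_singleton_iff: "(y::'a::ab_group_add) \<in> A + {v} \<longleftrightarrow> y - v \<in> A"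
  by (auto simp: set_plus_def algebra_simps) (metis diff_add_cancel add.commute)

section \<open>The entry time into a set that is stable under a cone\<close>

locale cone_stable_set =
  fixes A D :: "'a::real_topological_vector_space set" and k :: 'a
  assumes cone: "cone D" and k_interior: "k \<in> interior D"
    and stable: "a \<in> A \<Longrightarrow> d \<in> D \<Longrightarrow> a + d \<in> A"
    and nonempty: "A \<noteq> {}" and proper: "A \<noteq> UNIV"
begin

definition entry_time :: "'a \<Rightarrow> real" where
  "entry_time y = Inf {t. y + t *\<^sub>R k \<in> A}"

lemma stable_interior: "a \<in> A \<Longrightarrow> d \<in> interior D \<Longrightarrow> a + d \<in> interior A"
  using interior_translate_subset stable by metis

lemma interior_stable: "a \<in> interior A \<Longrightarrow> d \<in> D \<Longrightarrow> a + d \<in> interior A"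
  using interior_translate_subset[of a A d A] stable by (simp add: add.commute)

lemma line_upward:
  assumes "y + s *\<^sub>R k \<in> A" "s < t"
  shows "y + t *\<^sub>R k \<in> interior A"
proof -
  have "(t - s) *\<^sub>R k \<in> interior D"
    using cone_interior_scaleR[OF cone k_interior] assms(2) by simp
  from stable_interior[OF assms(1) this] show ?thesis
    by (simp add: algebra_simps)
qed

lemma line_meets: "{t. y + t *\<^sub>R k \<in> A} \<noteq> {}"
proof -
  obtain a where "a \<in> A"
    using nonempty by auto
  moreover obtain t where "t *\<^sub>R k + (y - a) \<in> D"
    using cone_interior_absorbs[OF cone k_interior] .
  ultimately have "a + (t *\<^sub>R k + (y - a)) \<in> A"
    by (rule stable)
  then show ?thesis
    by (auto simp: algebra_simps)
qed

text \<open>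
  If the line entered \<open>A\<close> arbitrarily early, then a point outside \<open>A\<close> would dominate one of its
  points in \<open>A\<close>.
\<close>

lemma line_bdd_below: "bdd_below {t. y + t *\<^sub>R k \<in> A}"
proof -
  obtain z where z: "z \<notin> A"
    using proper by auto
  obtain t where t: "t *\<^sub>R k + (z - y) \<in> D"
    using cone_interior_absorbs[OF cone k_interior] .
  have "- t \<le> s" if "y + s *\<^sub>R k \<in> A" for s
  proof (rule ccontr)
    assume "\<not> - t \<le> s"
    with line_upward[OF that] have "y + (- t) *\<^sub>R k \<in> A"
      using interior_subset by (metis not_le subsetD)
    from stable[OF this t] z show False
      by simp
  qed
  then show ?thesis
    by (intro bdd_belowI) auto
qed

text \<open>
  A parameter beyond the infimum is interior because some earlier point of the line is in \<open>A\<close> and a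
  positive multiple of \<open>k\<close> is interior to \<open>D\<close>. Conversely, an interior point can be moved a little
  along \<open>-k\<close> within \<open>A\<close>.
\<close>

lemma entry_time_less_iff: "entry_time y < r \<longleftrightarrow> y + r *\<^sub>R k \<in> interior A"
proof
  assume "entry_time y < r"
  then obtain t where "y + t *\<^sub>R k \<in> A" "t < r"
    unfolding entry_time_def using cInf_less_iff[OF line_meets line_bdd_below] by auto
  then show "y + r *\<^sub>R k \<in> interior A"
    by (rule line_upward)
next
  assume "y + r *\<^sub>R k \<in> interior A"
  then obtain e where e: "e > 0" "\<And>t. \<bar>t\<bar> \<le> e \<Longrightarrow> y + r *\<^sub>R k + t *\<^sub>R k \<in> interior A"
    using open_contains_segment_around[OF open_interior] by metis
  then have "y + r *\<^sub>R k + (- e) *\<^sub>R k \<in> A"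
    using interior_subset by (metis abs_minus_cancel abs_of_pos order_refl subsetD)
  then have "y + (r - e) *\<^sub>R k \<in> A"
    by (simp add: algebra_simps)
  then have "entry_time y \<le> r - e"
    unfolding entry_time_def by (intro cInf_lower line_bdd_below) simp
  with e show "entry_time y < r"
    by simp
qed

lemma entry_time_le: "y + r *\<^sub>R k \<in> A \<Longrightarrow> entry_time y \<le> r"
  unfolding entry_time_def by (intro cInf_lower line_bdd_below) simp

lemma entry_time_shift: "entry_time (y + s *\<^sub>R k) = entry_time y - s"
proof -
  have "entry_time (y + s *\<^sub>R k) < r \<longleftrightarrow> entry_time y - s < r" for r
    using entry_time_less_iff[of "y + s *\<^sub>R k" r] entry_time_less_iff[of y "s + r"]
    by (simp add: algebra_simps less_diff_eq diff_less_eq)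
  then show ?thesis
    by (metis less_irrefl linorder_neqE_linordered_idom)
qed

lemma entry_time_antimono:
  assumes "d \<in> D"
  shows "entry_time (y + d) \<le> entry_time y"
proof (rule dense_ge)
  fix r assume "entry_time y < r"
  then have "y + r *\<^sub>R k + d \<in> interior A"
    using assms by (simp add: entry_time_less_iff interior_stable)
  then have "entry_time (y + d) < r"
    by (simp add: entry_time_less_iff algebra_simps)
  then show "entry_time (y + d) \<le> r"
    by simp
qed

text \<open>
  An interior \<open>d\<close> leaves room for a step back: \<open>d - e k \<in> D\<close> for some \<open>e > 0\<close>, and by the shift rule
  that step accounts for a decrease of \<open>e\<close>.
\<close>

lemma entry_time_strict_antimono:
  assumes "d \<in> interior D"
  shows "entry_time (y + d) < entry_time y"
proof -
  obtain e where e: "e > 0" "\<And>t. \<bar>t\<bar> \<le> e \<Longrightarrow> d + t *\<^sub>R k \<in> interior D"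
    using open_contains_segment_around[OF open_interior assms] by metis
  then have "d + (- e) *\<^sub>R k \<in> D"
    using interior_subset by (metis abs_minus_cancel abs_of_pos order_refl subsetD)
  from entry_time_antimono[OF this, of y] entry_time_shift[of "y + d" "- e"] e(1)
  show ?thesis
    by (simp add: algebra_simps)
qed

text \<open>
  The vectors \<open>x\<close> for which both \<open>e k + (x - y)\<close> and \<open>e k - (x - y)\<close> lie in the interior of \<open>D\<close> form a
  neighbourhood of \<open>y\<close>; monotonicity along \<open>D\<close> and the shift rule bound the oscillation on it by \<open>e\<close>.
\<close>

lemma continuous_on_entry_time: "continuous_on UNIV entry_time"
proof -
  have "(entry_time \<longlongrightarrow> entry_time y) (nhds y)" for y
  proof (rule tendstoI)
    fix e' :: real assume "e' > 0"
    \<comment> \<open>Half of \<open>e'\<close>, because the shift rule yields only a non-strict bound.\<close>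
    define e where "e = e' / 2"
    then have e: "e > 0" "e < e'"
      using \<open>e' > 0\<close> by auto
    define U where "U = (\<lambda>x. e *\<^sub>R k + (x - y)) -` interior D \<inter> (\<lambda>x. e *\<^sub>R k + (y - x)) -` interior D"
    have "open U"
      unfolding U_def
      by (intro open_Int open_vimage open_interior continuous_on_add continuous_on_diff
          continuous_on_id continuous_on_const)
    moreover have "y \<in> U"
      using cone_interior_scaleR[OF cone k_interior e(1)] by (simp add: U_def)
    moreover have "dist (entry_time x) (entry_time y) < e'" if "x \<in> U" for x
    proof -
      have "e *\<^sub>R k + (x - y) \<in> D" "e *\<^sub>R k + (y - x) \<in> D"
        using that interior_subset by (auto simp: U_def)
      from this[THEN entry_time_antimono]
      have "entry_time (x + e *\<^sub>R k) \<le> entry_time y" "entry_time (y + e *\<^sub>R k) \<le> entry_time x"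
        by (metis add.commute add.left_commute diff_add_cancel)+
      then show ?thesis
        using e by (auto simp: entry_time_shift dist_real_def)
    qed
    ultimately show "\<forall>\<^sub>F x in nhds y. dist (entry_time x) (entry_time y) < e'"
      by (auto simp: eventually_nhds)
  qed
  then show ?thesis
    by (auto simp: continuous_on_def intro: tendsto_mono[OF at_within_le_nhds])
qed

lemma convex_on_entry_time:
  assumes "convex A"
  shows "convex_on UNIV entry_time"
proof (rule convex_onI)
  fix u :: real and x y assume u: "0 < u" "u < 1"
  show "entry_time ((1 - u) *\<^sub>R x + u *\<^sub>R y) \<le> (1 - u) * entry_time x + u * entry_time y"
  proof (rule field_le_epsilon)
    fix e :: real assume "e > 0"
    define s t where "s = entry_time x + e" and "t = entry_time y + e"
    have "x + s *\<^sub>R k \<in> A" "y + t *\<^sub>R k \<in> A"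
      using entry_time_less_iff[of x s] entry_time_less_iff[of y t] \<open>e > 0\<close> interior_subset
      by (auto simp: s_def t_def)
    then have "(1 - u) *\<^sub>R (x + s *\<^sub>R k) + u *\<^sub>R (y + t *\<^sub>R k) \<in> A"
      using assms u by (intro convexD) auto
    then have "entry_time ((1 - u) *\<^sub>R x + u *\<^sub>R y) \<le> (1 - u) * s + u * t"
      by (intro entry_time_le) (simp add: algebra_simps)
    then show "entry_time ((1 - u) *\<^sub>R x + u *\<^sub>R y)
        \<le> (1 - u) * entry_time x + u * entry_time y + e"
      by (simp add: s_def t_def algebra_simps)
  qed
qed simp

lemma translation_functional_neg_direction:
  "translation_functional A (- k) y = Some (ereal (entry_time y))"
  unfolding translation_functional_def mem_plus_singleton_iff
  using inf_nu_eq_Inf[OF line_meets[of y] line_bdd_below] by (simp add: entry_time_def)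

text \<open>
  By the equivalence for interior points, the parameters \<open>t\<close> with \<open>y - t k\<close> outside the interior of
  \<open>A\<close> form the closed half-line starting at \<open>- entry_time y\<close>.
\<close>

lemma translation_functional_complement_interior:
  "translation_functional (UNIV - interior A) k y = Some (ereal (- entry_time y))"
proof -
  have "y - t *\<^sub>R k \<in> UNIV - interior A \<longleftrightarrow> - entry_time y \<le> t" for t
    using entry_time_less_iff[of y "- t"] by auto
  then have "{t. y \<in> (UNIV - interior A) + {t *\<^sub>R k}} = {- entry_time y..}"
    by (auto simp only: mem_plus_singleton_iff)
  then show ?thesis
    by (simp add: translation_functional_def inf_nu_eq_Inf)
qed

lemma zero_notin_interior: "0 \<notin> interior D"
  using entry_time_strict_antimono[of 0 0] by auto

end

section \<open>Weakly efficient points\<close>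

text \<open>
  Only the inclusion \<open>int (F + D) \<subseteq> F + int D\<close> needs more than openness of translates of \<open>int D\<close>:
  \<open>y = f + d + e k\<close> for some small \<open>e > 0\<close>, and \<open>d + e k\<close> is interior to \<open>D\<close>.
\<close>

lemma interior_plus_cone:
  fixes F D :: "'a::real_topological_vector_space set"
  assumes "cone D" "convex D" "k \<in> interior D"
  shows "interior (F + D) = F + interior D"
proof
  show "F + interior D \<subseteq> interior (F + D)"
    by (auto simp: set_plus_def intro!: interior_translate_subset)
  show "interior (F + D) \<subseteq> F + interior D"
  proof
    fix y assume "y \<in> interior (F + D)"
    then obtain e where e: "e > 0" "\<And>t. \<bar>t\<bar> \<le> e \<Longrightarrow> y + t *\<^sub>R k \<in> interior (F + D)"
      using open_contains_segment_around[OF open_interior] by metis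
    then have "y + (- e) *\<^sub>R k \<in> F + D"
      using interior_subset by (metis abs_minus_cancel abs_of_pos order_refl subsetD)
    then obtain f d where fd: "f \<in> F" "d \<in> D" "y - e *\<^sub>R k = f + d"
      by (auto simp: set_plus_def)
    have "d + e *\<^sub>R k \<in> interior D"
      using interior_translate_subset[OF cone_interior_scaleR[OF assms(1,3) e(1)]] fd(2)
        assms(1,2) by (metis convex_cone)
    moreover have "y = f + (d + e *\<^sub>R k)"
      using fd(3) by (simp add: algebra_simps)
    ultimately show "y \<in> F + interior D"
      using fd(1) by (auto intro: set_plus_intro)
  qed
qed

lemma WEff_eq_diff:
  assumes "0 \<notin> interior D"
  shows "WEff F D = F - (F + interior D)"
proof -
  have "y \<in> F + interior D \<longleftrightarrow> (\<exists>d\<in>interior D. y - d \<in> F)" for y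
    unfolding set_plus_def mem_Collect_eq by (metis add_diff_cancel_right' diff_add_cancel)
  moreover have "y - d \<noteq> y" if "d \<in> interior D" for y d
    using that assms by auto
  ultimately show ?thesis
    unfolding WEff_def Eff_def by blast
qed

theorem proposition8:
  fixes F D B :: "'a::real_topological_vector_space set"
    and k :: 'a
    and \<phi>FD \<phi>B :: "'a \<Rightarrow> ereal option"
  assumes D_cone: "cone D"
    and D_convex: "convex D"
    and k_int: "k \<in> interior D"
    and FD_nonempty: "F + D \<noteq> {}"
    and FD_closed: "closed (F + D)"
    and FD_proper: "F + D \<noteq> UNIV"
  defines "B \<equiv> UNIV - interior (F + D)"
    and "\<phi>FD \<equiv> translation_functional (F + D) (- k)"
    and "\<phi>B \<equiv> translation_functional B k"
  shows "WEff F D = {y0 \<in> F. \<phi>FD y0 = Some 0 \<and> is_maximum_on \<phi>FD F (Some 0)}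
    \<and> WEff F D = {y0 \<in> F. \<phi>B y0 = Some 0 \<and> is_minimum_on \<phi>B F (Some 0)}
    \<and> finite_valued \<phi>FD \<and> continuous_on UNIV (real_valued \<phi>FD)
    \<and> finite_valued \<phi>B \<and> continuous_on UNIV (real_valued \<phi>B)
    \<and> strictly_monotone_wrt (interior D) (real_valued \<phi>B)
    \<and> strictly_monotone_wrt (uminus ` interior D) (real_valued \<phi>FD)
    \<and> (convex (F + D) \<longrightarrow>
          convex_on UNIV (real_valued \<phi>FD) \<and> concave_on UNIV (real_valued \<phi>B))"
proof -
  have D_add: "d + d' \<in> D" if "d \<in> D" "d' \<in> D" for d d'
    using that D_cone D_convex by (metis convex_cone)
  interpret cone_stable_set "F + D" D k
  proof
    show "a + d \<in> F + D" if "a \<in> F + D" "d \<in> D" for a d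
      using that D_add by (auto simp: set_plus_def add.assoc) blast
  qed (use D_cone k_int FD_nonempty FD_proper in auto)
  have \<phi>FD: "\<phi>FD = (\<lambda>y. Some (ereal (entry_time y)))"
    by (auto simp: \<phi>FD_def translation_functional_neg_direction)
  have \<phi>B: "\<phi>B = (\<lambda>y. Some (ereal (- entry_time y)))"
    by (auto simp: \<phi>B_def B_def translation_functional_complement_interior)
  have real_valued: "real_valued \<phi>FD = entry_time" "real_valued \<phi>B = (\<lambda>y. - entry_time y)"
    by (auto simp: real_valued_def \<phi>FD \<phi>B)

  have "0 \<in> D"
    using D_cone k_int interior_subset by (metis cone_contains_0 empty_iff subsetD)
  then have nonpos: "entry_time y \<le> 0" if "y \<in> F" for y
    using that by (intro entry_time_le) (metis add.right_neutral scaleR_zero_left set_plus_intro)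
  have weff: "WEff F D = {y \<in> F. entry_time y = 0}"
  proof -
    have "y \<in> F + interior D \<longleftrightarrow> entry_time y < 0" for y
      using entry_time_less_iff[of y 0] interior_plus_cone[OF D_cone D_convex k_int] by simp
    then show ?thesis
      using WEff_eq_diff[OF zero_notin_interior, of F] nonpos by (auto simp: less_le)
  qed

  have "WEff F D = {y0 \<in> F. \<phi>FD y0 = Some 0 \<and> is_maximum_on \<phi>FD F (Some 0)}"
    using nonpos unfolding weff by (auto simp: \<phi>FD is_maximum_on_def le_nu_def image_iff)
  moreover have "WEff F D = {y0 \<in> F. \<phi>B y0 = Some 0 \<and> is_minimum_on \<phi>B F (Some 0)}"
    using nonpos unfolding weff by (auto simp: \<phi>B is_minimum_on_def le_nu_def image_iff)
  moreover have "finite_valued \<phi>FD" "finite_valued \<phi>B"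
    by (auto simp: finite_valued_def \<phi>FD \<phi>B)
  moreover have "continuous_on UNIV (real_valued \<phi>FD)" "continuous_on UNIV (real_valued \<phi>B)"
    unfolding real_valued by (intro continuous_on_minus continuous_on_entry_time)+
  moreover have "strictly_monotone_wrt (interior D) (real_valued \<phi>B)"
    unfolding strictly_monotone_wrt_def real_valued
    by (metis DiffD1 add.commute diff_add_cancel entry_time_strict_antimono neg_less_iff_less)
  moreover have "strictly_monotone_wrt (uminus ` interior D) (real_valued \<phi>FD)"
    unfolding strictly_monotone_wrt_def real_valued
  proof (intro allI impI)
    fix y1 y2 assume "y2 - y1 \<in> uminus ` interior D - {0}"
    then obtain d where "d \<in> interior D" "y2 - y1 = - d"
      by auto
    then have "y1 = y2 + d"
      by (simp add: algebra_simps)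
    with \<open>d \<in> interior D\<close> show "entry_time y1 < entry_time y2"
      by (simp add: entry_time_strict_antimono)
  qed
  moreover have "convex_on UNIV (real_valued \<phi>FD) \<and> concave_on UNIV (real_valued \<phi>B)"
    if "convex (F + D)"
    using convex_on_entry_time[OF that] by (simp add: real_valued concave_on_def)
  ultimately show ?thesis
    by blast
qed

end
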